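(* Let $\sigma$ be the substitution on formulas of classical propositional logic in the variables $x_0,x_1,x_2,\dots$ defined by $$\sigma(x_0)=\neg x_0,\qquad \sigma(x_i)=x_i\,\triangle\,(x_0\land x_1\land\cdots\land x_{i-1})\quad\text{for } i>0 .$$ Then, from the set of boolean tautologies plus any given non-tautology, one can derive every formula using only Modus Ponens and the substitution $\sigma$. That is: if $\Theta$ is the set of all boolean tautologies, $r$ is a formula with $r\notin\Theta$, and $s$ is any formula, then there is a finite sequence of formulas $r_1,\dots,r_h=s$ such that, for every $j$, either $r_j\in\Theta\cup\{r\}$, or there exist $k,m<j$ such that $r_m$ is the formula $r_k\to r_j$, or there exists $k<j$ with $r_j=\sigma(r_k)$.
   Context: Formulas are built from the propositional variables $x_i$ $(i<\omega)$ and the constants $0,1$ by means of the two binary connectives $\star$ (conjunction) and $\to$ (implication). Other connectives are abbreviations: $r\land s$ stands for $r\star(r\to s)$, $r\lor s$ for $((r\to s)\to s)\land((s\to r)\to r)$, $\neg r$ for $r\to 0$, and $r\triangle s$ for $(r\land\neg s)\lor(\neg r\land s)$ (boolean symmetric difference). A boolean tautology is a formula that takes value $1$ under every assignment of values in $\{0,1\}$ to its variables, with $\star,\to$ computed by the classical truth tables of conjunction and implication. A substitution is a map from formulas to formulas that fixes $0$ and $1$ and commutes with $\star$ and $\to$; it is determined by its values on the variables (all variables are replaced simultaneously). *)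

theory Defs
  imports Main
begin

datatype formula =
    Var nat
  | Zero  (\<open>\<^bold>0\<close>)
  | One   (\<open>\<^bold>1\<close>)
  | Star formula formula  (infixl \<open>\<^bold>\<star>\<close> 70)
  | Imp formula formula   (infixr \<open>\<^bold>\<rightarrow>\<close> 55)

definition Neg :: "formula \<Rightarrow> formula"  (\<open>\<^bold>\<not> _\<close> [75] 75)
  where "\<^bold>\<not> r = r \<^bold>\<rightarrow> \<^bold>0"

definition And :: "formula \<Rightarrow> formula \<Rightarrow> formula"  (infixl \<open>\<^bold>\<and>\<close> 65)
  where "r \<^bold>\<and> s = r \<^bold>\<star> (r \<^bold>\<rightarrow> s)"

definition Or :: "formula \<Rightarrow> formula \<Rightarrow> formula"  (infixl \<open>\<^bold>\<or>\<close> 60)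
  where "r \<^bold>\<or> s = ((r \<^bold>\<rightarrow> s) \<^bold>\<rightarrow> s) \<^bold>\<and> ((s \<^bold>\<rightarrow> r) \<^bold>\<rightarrow> r)"

definition Symdiff :: "formula \<Rightarrow> formula \<Rightarrow> formula"  (infixl \<open>\<^bold>\<triangle>\<close> 62)
  where "r \<^bold>\<triangle> s = (r \<^bold>\<and> \<^bold>\<not> s) \<^bold>\<or> (\<^bold>\<not> r \<^bold>\<and> s)"

primrec eval :: "(nat \<Rightarrow> bool) \<Rightarrow> formula \<Rightarrow> bool" where
  "eval v (Var i) = v i"
| "eval v \<^bold>0 = False"
| "eval v \<^bold>1 = True"
| "eval v (r \<^bold>\<star> s) = (eval v r \<and> eval v s)"
| "eval v (r \<^bold>\<rightarrow> s) = (eval v r \<longrightarrow> eval v s)"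

definition tautologies :: "formula set"
  where "tautologies = {r. \<forall>v. eval v r}"

definition is_substitution :: "(formula \<Rightarrow> formula) \<Rightarrow> bool" where
  "is_substitution f \<longleftrightarrow>
     f \<^bold>0 = \<^bold>0 \<and> f \<^bold>1 = \<^bold>1 \<and>
     (\<forall>r s. f (r \<^bold>\<star> s) = f r \<^bold>\<star> f s) \<and>
     (\<forall>r s. f (r \<^bold>\<rightarrow> s) = f r \<^bold>\<rightarrow> f s)"

primrec subst :: "(nat \<Rightarrow> formula) \<Rightarrow> formula \<Rightarrow> formula" where
  "subst g (Var i) = g i"
| "subst g \<^bold>0 = \<^bold>0"
| "subst g \<^bold>1 = \<^bold>1"
| "subst g (r \<^bold>\<star> s) = subst g r \<^bold>\<star> subst g s"
| "subst g (r \<^bold>\<rightarrow> s) = subst g r \<^bold>\<rightarrow> subst g s"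

lemma is_substitution_subst: "is_substitution (subst g)"
  by (simp add: is_substitution_def)

lemma is_substitution_unique:
  assumes "is_substitution f" and "\<And>i. f (Var i) = g i"
  shows "f = subst g"
proof
  fix r show "f r = subst g r"
    using assms by (induction r) (auto simp: is_substitution_def)
qed

(* conj_vars n is x_0 \<and> ... \<and> x_n, both end points included, bracketed to the left. *)
primrec conj_vars :: "nat \<Rightarrow> formula" where
  "conj_vars 0 = Var 0"
| "conj_vars (Suc n) = conj_vars n \<^bold>\<and> Var (Suc n)"

definition sigma :: "formula \<Rightarrow> formula"  (\<open>\<sigma>\<close>) where
  "\<sigma> = subst (\<lambda>i. if i = 0 then \<^bold>\<not> Var 0 else Var i \<^bold>\<triangle> conj_vars (i - 1))"

definition is_derivation ::
  "(formula \<Rightarrow> formula) \<Rightarrow> formula set \<Rightarrow> formula list \<Rightarrow> bool" where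
  "is_derivation f A rs \<longleftrightarrow>
     (\<forall>j < length rs.
        rs ! j \<in> A \<or>
        (\<exists>k < j. \<exists>m < j. rs ! m = rs ! k \<^bold>\<rightarrow> rs ! j) \<or>
        (\<exists>k < j. rs ! j = f (rs ! k)))"

end

theory Submission
  imports Defs
begin

text \<open>
  On assignments, \<open>\<sigma>\<close> acts by pullback: evaluating \<open>\<sigma> r\<close> under \<open>v\<close> is evaluating \<open>r\<close> under another
  assignment \<open>increment v\<close> (lemma \<open>eval_sigma\<close>). Read \<open>v\<close> as a binary expansion with least significant
  bit \<open>v 0\<close>. Then bit \<open>i\<close> is flipped exactly when all lower bits are \<open>1\<close>, which is the carry rule for
  adding one: the action is the binary odometer. On the first \<open>n\<close> bits, adding one permutes the
  \<open>2 ^ n\<close> bit patterns in a single cycle (lemma \<open>odometer_transitive\<close>).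

  Now suppose that \<open>r\<close>, whose variables are among the first \<open>n\<close>, is false under \<open>v\<close>. Starting from
  any assignment, some number \<open>k < 2 ^ n\<close> of increments leads to one that agrees with \<open>v\<close> on
  these variables, so some \<open>\<sigma>\<^sup>k r\<close> is false there. Hence the finitely many formulas
  \<open>\<sigma>\<^sup>k r\<close> with \<open>k < 2 ^ n\<close>, all derivable from \<open>r\<close> by substitution alone, are jointly unsatisfiable.
  They entail every \<open>s\<close>, and an entailment from finitely many premises becomes a derivation by
  detaching these premises one at a time from a nested implication that is a tautology
  (lemma \<open>derivable_consequence\<close>).
\<close>

section \<open>Derivability\<close>

definition derivable :: "(formula \<Rightarrow> formula) \<Rightarrow> formula set \<Rightarrow> formula \<Rightarrow> bool" where
  "derivable f A s \<longleftrightarrow> (\<exists>rs. rs \<noteq> [] \<and> last rs = s \<and> is_derivation f A rs)"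

lemma is_derivation_append:
  assumes "is_derivation f A rs" and "is_derivation f A ts"
  shows "is_derivation f A (rs @ ts)"
  unfolding is_derivation_def
proof (intro allI impI)
  fix j assume j: "j < length (rs @ ts)"
  let ?us = "rs @ ts"
  show "?us ! j \<in> A \<or> (\<exists>k<j. \<exists>m<j. ?us ! m = ?us ! k \<^bold>\<rightarrow> ?us ! j) \<or> (\<exists>k<j. ?us ! j = f (?us ! k))"
  proof (cases "j < length rs")
    case True
    have "?us ! i = rs ! i" if "i \<le> j" for i
      using True that by (simp add: nth_append)
    moreover have "rs ! j \<in> A \<or> (\<exists>k<j. \<exists>m<j. rs ! m = rs ! k \<^bold>\<rightarrow> rs ! j) \<or> (\<exists>k<j. rs ! j = f (rs ! k))"
      using assms(1) True unfolding is_derivation_def by blast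
    ultimately show ?thesis
      by (metis less_imp_le order_refl)
  next
    case False
    define i where "i = j - length rs"
    have ji: "j = length rs + i" and i: "i < length ts"
      using False j by (auto simp: i_def)
    have shift: "?us ! (length rs + k) = ts ! k" for k
      by simp
    have "ts ! i \<in> A \<or> (\<exists>k<i. \<exists>m<i. ts ! m = ts ! k \<^bold>\<rightarrow> ts ! i) \<or> (\<exists>k<i. ts ! i = f (ts ! k))"
      using assms(2) i unfolding is_derivation_def by blast
    then show ?thesis
      unfolding ji by (metis shift nat_add_left_cancel_less)
  qed
qed

lemma is_derivation_snoc:
  assumes "is_derivation f A rs"
    and "t \<in> A \<or> (\<exists>p\<in>set rs. (p \<^bold>\<rightarrow> t) \<in> set rs) \<or> (\<exists>p\<in>set rs. t = f p)"
  shows "is_derivation f A (rs @ [t])"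
  unfolding is_derivation_def
proof (intro allI impI)
  fix j assume "j < length (rs @ [t])"
  let ?us = "rs @ [t]"
  have old: "?us ! i = rs ! i" if "i < length rs" for i
    using that by (simp add: nth_append)
  consider "j < length rs" | "j = length rs"
    using \<open>j < length ?us\<close> by fastforce
  then show "?us ! j \<in> A \<or> (\<exists>k<j. \<exists>m<j. ?us ! m = ?us ! k \<^bold>\<rightarrow> ?us ! j) \<or> (\<exists>k<j. ?us ! j = f (?us ! k))"
  proof cases
    case 1
    then have "rs ! j \<in> A \<or> (\<exists>k<j. \<exists>m<j. rs ! m = rs ! k \<^bold>\<rightarrow> rs ! j) \<or> (\<exists>k<j. rs ! j = f (rs ! k))"
      using assms(1) unfolding is_derivation_def by blast
    with 1 show ?thesis
      by (metis old less_trans)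
  next
    case 2
    have "\<exists>k<j. ?us ! k = p" if "p \<in> set rs" for p
      using that 2 old by (auto simp: in_set_conv_nth)
    moreover have "?us ! j = t"
      using 2 by simp
    ultimately show ?thesis
      using assms(2) by metis
  qed
qed

lemma derivable_axiom: "t \<in> A \<Longrightarrow> derivable f A t"
  unfolding derivable_def by (rule exI[of _ "[t]"]) (simp add: is_derivation_def)

lemma derivable_mp:
  assumes "derivable f A (p \<^bold>\<rightarrow> t)" and "derivable f A p"
  shows "derivable f A t"
proof -
  obtain rs ts where rs: "rs \<noteq> []" "last rs = (p \<^bold>\<rightarrow> t)" "is_derivation f A rs"
    and ts: "ts \<noteq> []" "last ts = p" "is_derivation f A ts"
    using assms unfolding derivable_def by blast
  have "(p \<^bold>\<rightarrow> t) \<in> set (rs @ ts)" "p \<in> set (rs @ ts)"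
    using rs(1,2) ts(1,2) by (metis Un_iff last_in_set set_append)+
  then have "is_derivation f A ((rs @ ts) @ [t])"
    using is_derivation_snoc is_derivation_append rs(3) ts(3) by blast
  then show ?thesis
    unfolding derivable_def by (metis snoc_eq_iff_butlast)
qed

lemma derivable_subst:
  assumes "derivable f A p"
  shows "derivable f A (f p)"
proof -
  obtain rs where rs: "rs \<noteq> []" "last rs = p" "is_derivation f A rs"
    using assms unfolding derivable_def by blast
  then have "is_derivation f A (rs @ [f p])"
    using is_derivation_snoc last_in_set by blast
  then show ?thesis
    unfolding derivable_def by (metis snoc_eq_iff_butlast)
qed

lemma derivable_subst_iterate: "derivable f A p \<Longrightarrow> derivable f A ((f ^^ k) p)"
  by (induction k) (auto intro: derivable_subst)

text \<open>
  The induction discharges one premise \<open>t\<close> at a time: it replaces the conclusion \<open>s\<close> by \<open>t \<^bold>\<rightarrow> s\<close>,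
  which the remaining premises entail, until only a tautology is left.
\<close>

lemma derivable_consequence:
  assumes "tautologies \<subseteq> A"
    and "\<And>t. t \<in> set ts \<Longrightarrow> derivable f A t"
    and "\<And>v. (\<And>t. t \<in> set ts \<Longrightarrow> eval v t) \<Longrightarrow> eval v s"
  shows "derivable f A s"
  using assms(2,3)
proof (induction ts arbitrary: s)
  case Nil
  then have "s \<in> tautologies"
    by (simp add: tautologies_def)
  with assms(1) show ?case
    by (blast intro: derivable_axiom)
next
  case (Cons t ts)
  have "derivable f A (t \<^bold>\<rightarrow> s)"
  proof (rule Cons.IH)
    show "derivable f A t'" if "t' \<in> set ts" for t'
      using that Cons.prems(1) by simp
    show "eval v (t \<^bold>\<rightarrow> s)" if "\<And>t'. t' \<in> set ts \<Longrightarrow> eval v t'" for v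
      using that Cons.prems(2)[of v] by auto
  qed
  moreover have "derivable f A t"
    using Cons.prems(1) by simp
  ultimately show ?case
    by (rule derivable_mp)
qed

section \<open>The substitution as a binary odometer\<close>

definition increment :: "(nat \<Rightarrow> bool) \<Rightarrow> nat \<Rightarrow> bool" where
  "increment v i \<longleftrightarrow> (v i \<noteq> (\<forall>j<i. v j))"

lemma eval_subst: "eval v (subst g r) = eval (\<lambda>i. eval v (g i)) r"
  by (induction r) auto

lemma eval_conj_vars: "eval v (conj_vars n) \<longleftrightarrow> (\<forall>j\<le>n. v j)"
  by (induction n) (auto simp: And_def le_Suc_eq)

lemma eval_sigma: "eval v (\<sigma> r) = eval (increment v) r"
proof -
  have "eval v (if i = 0 then \<^bold>\<not> Var 0 else Var i \<^bold>\<triangle> conj_vars (i - 1)) = increment v i" for i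
  proof (cases i)
    case 0
    then show ?thesis
      by (simp add: increment_def Neg_def)
  next
    case (Suc n)
    then show ?thesis
      by (auto simp: increment_def Symdiff_def Or_def And_def Neg_def eval_conj_vars less_Suc_eq_le)
  qed
  then show ?thesis
    by (simp add: sigma_def eval_subst)
qed

lemma eval_sigma_iterate: "eval v ((\<sigma> ^^ k) r) = eval ((increment ^^ k) v) r"
  by (induction k arbitrary: v) (simp_all add: eval_sigma funpow_swap1[of increment])

fun binary_value :: "nat \<Rightarrow> (nat \<Rightarrow> bool) \<Rightarrow> nat" where
  "binary_value 0 v = 0"
| "binary_value (Suc n) v = binary_value n v + (if v n then 2 ^ n else 0)"

lemma binary_value_less: "binary_value n v < 2 ^ n"
  by (induction n) auto

lemma binary_value_inj:
  "binary_value n u = binary_value n v \<Longrightarrow> i < n \<Longrightarrow> u i = v i"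
proof (induction n)
  case (Suc n)
  have "binary_value n u = binary_value n v \<and> u n = v n"
    using Suc.prems(1) binary_value_less[of n u] binary_value_less[of n v]
    by (auto split: if_splits)
  with Suc show ?case
    by (auto simp: less_Suc_eq)
qed simp

text \<open>
  The carry out of the first \<open>n\<close> bits occurs when they are all \<open>1\<close>; recording it keeps
  the statement strong enough for the induction on \<open>n\<close>, where it decides whether bit \<open>n\<close> flips.
\<close>

lemma binary_value_increment_carry:
  "binary_value n (increment v) + (if \<forall>j<n. v j then 2 ^ n else 0) = binary_value n v + 1"
proof (induction n)
  case (Suc n)
  have "(\<forall>j<Suc n. v j) \<longleftrightarrow> (\<forall>j<n. v j) \<and> v n"
    by (auto simp: less_Suc_eq)
  with Suc show ?case
    by (auto simp: increment_def split: if_splits)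
qed simp

lemma binary_value_increment: "binary_value n (increment v) = (binary_value n v + 1) mod 2 ^ n"
proof -
  have "(binary_value n v + 1) mod 2 ^ n
      = (binary_value n (increment v) + (if \<forall>j<n. v j then 2 ^ n else 0)) mod 2 ^ n"
    by (simp only: binary_value_increment_carry)
  also have "\<dots> = binary_value n (increment v)"
    using binary_value_less[of n "increment v"] by simp
  finally show ?thesis ..
qed

lemma binary_value_increment_iterate:
  "binary_value n ((increment ^^ k) v) = (binary_value n v + k) mod 2 ^ n"
proof (induction k)
  case 0
  show ?case
    using binary_value_less[of n v] by simp
next
  case (Suc k)
  then show ?case
    by (simp add: binary_value_increment mod_Suc_eq)
qed

lemma odometer_transitive:
  obtains k where "k < 2 ^ n" and "\<And>i. i < n \<Longrightarrow> (increment ^^ k) u i = v i"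
proof -
  \<comment> \<open>The difference of the two values modulo \<open>2 ^ n\<close>, with \<open>2 ^ n\<close> added to keep the subtraction exact.\<close>
  define k where "k = (binary_value n v + 2 ^ n - binary_value n u) mod 2 ^ n"
  have "binary_value n ((increment ^^ k) u)
      = (binary_value n u + (binary_value n v + 2 ^ n - binary_value n u)) mod 2 ^ n"
    by (simp add: binary_value_increment_iterate k_def mod_add_right_eq)
  also have "\<dots> = (binary_value n v + 2 ^ n) mod 2 ^ n"
    using binary_value_less[of n u] by simp
  also have "\<dots> = binary_value n v"
    using binary_value_less[of n v] by simp
  finally have "binary_value n ((increment ^^ k) u) = binary_value n v" .
  then have "(increment ^^ k) u i = v i" if "i < n" for i
    using binary_value_inj that by blast
  moreover have "k < 2 ^ n"
    by (simp add: k_def)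
  ultimately show thesis
    using that by blast
qed

section \<open>Deriving every formula\<close>

lemma eval_finite_support:
  "\<exists>n. \<forall>u v. (\<forall>i<n. u i = v i) \<longrightarrow> eval u r = eval v r"
proof (induction r)
  case (Var i)
  show ?case
    by (rule exI[of _ "Suc i"]) simp
next
  case (Star r s)
  then obtain m n where
    "\<forall>u v. (\<forall>i<m. u i = v i) \<longrightarrow> eval u r = eval v r"
    "\<forall>u v. (\<forall>i<n. u i = v i) \<longrightarrow> eval u s = eval v s"
    by blast
  then show ?case
    by (intro exI[of _ "max m n"]) (simp add: less_max_iff_disj, blast)
next
  case (Imp r s)
  then obtain m n where
    "\<forall>u v. (\<forall>i<m. u i = v i) \<longrightarrow> eval u r = eval v r"
    "\<forall>u v. (\<forall>i<n. u i = v i) \<longrightarrow> eval u s = eval v s"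
    by blast
  then show ?case
    by (intro exI[of _ "max m n"]) (simp add: less_max_iff_disj, blast)
qed simp_all

lemma sigma_iterates_unsatisfiable:
  assumes "r \<notin> tautologies"
  obtains N where "\<And>u. \<exists>k<N. \<not> eval u ((\<sigma> ^^ k) r)"
proof -
  obtain v where v: "\<not> eval v r"
    using assms by (auto simp: tautologies_def)
  obtain n where n: "\<And>u v. (\<forall>i<n. u i = v i) \<Longrightarrow> eval u r = eval v r"
    using eval_finite_support[of r] by blast
  have "\<exists>k<2 ^ n. \<not> eval u ((\<sigma> ^^ k) r)" for u
  proof -
    obtain k where k: "k < 2 ^ n" "\<And>i. i < n \<Longrightarrow> (increment ^^ k) u i = v i"
      using odometer_transitive by blast
    then have "\<not> eval ((increment ^^ k) u) r"
      using n v by blast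
    with k(1) show ?thesis
      by (auto simp: eval_sigma_iterate)
  qed
  then show thesis
    by (rule that)
qed

theorem theorem4p8:
  fixes r s :: formula
  assumes "r \<notin> tautologies"
  shows "\<exists>rs. rs \<noteq> [] \<and> last rs = s \<and> is_derivation \<sigma> (tautologies \<union> {r}) rs"
proof -
  obtain N where N: "\<And>u. \<exists>k<N. \<not> eval u ((\<sigma> ^^ k) r)"
    using sigma_iterates_unsatisfiable[OF assms] by blast
  let ?ts = "map (\<lambda>k. (\<sigma> ^^ k) r) [0..<N]"
  have "derivable \<sigma> (tautologies \<union> {r}) s"
  proof (rule derivable_consequence)
    show "derivable \<sigma> (tautologies \<union> {r}) t" if "t \<in> set ?ts" for t
      using that by (auto intro: derivable_subst_iterate derivable_axiom)
    show "eval v s" if "\<And>t. t \<in> set ?ts \<Longrightarrow> eval v t" for v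
      using that N[of v] by fastforce
  qed blast
  then show ?thesis
    unfolding derivable_def .
qed

end
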